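(* Let $V$ be a finite-dimensional complex vector space, $B\subset V^*$ a finite spanning multiset of nonzero vectors, $\mathcal{H}=\mathcal{H}_B$ the central arrangement in $V$ defined by $B$, and $\mathcal{H}^c_B\subset(\mathbb{C}^\times)^B$ the image of $V\smallsetminus\mathcal{H}$ under $v\mapsto(\langle b,v\rangle)_{b\in B}$. For each cone $\sigma_{\mathcal{L}}$ in the fine subdivision of $\mathscr{T}(B)$, where $\mathcal{L}$ is a flag of flats of $\mathcal{H}$, we have $\mathrm{in}_{\sigma_{\mathcal{L}}}\mathcal{H}_B^c=\mathcal{H}(\mathcal{L})^c$. When $\mathcal{L}$ is not the flag $\{0\}\subset V$, we have $\mathscr{P}^\infty_{\sigma_{\mathcal{L}}}(\mathcal{H}_B^c)=\overline{c\mathscr{A}(\mathcal{H}(\mathcal{L})^c)}$. In the decomposition $\overline{c\mathscr{A}(\mathcal{H}^c_B)}=\bigcup_{\mathcal{L}}c\mathscr{A}(\mathcal{H}(\mathcal{L})^c)$ over all flags of flats, the closure of each term with $\mathcal{L}\ne(\{0\}\subset V)$ is a stratum of $\mathscr{P}^\infty(\mathcal{H}_B^c)$ for a cone in the fine subdivision of $\mathscr{T}(B)$.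
   Context: $\mathbb{T}\subset\mathbb{C}$ is the unit circle; $\mathrm{Arg}$ is coordinatewise $z\mapsto z/|z|$; $c\mathscr{A}(X)=\mathrm{Arg}(X)$. A flat of $\mathcal{H}$ is a linear subspace of $V$ that is an intersection of hyperplanes of $\mathcal{H}$. A flag of flats is $\mathcal{L}=(\{0\}=L_0\subsetneq L_1\subsetneq\dots\subsetneq L_k\subsetneq L_{k+1}=V)$ with each $L_i$ a flat; put $F_i=\{b\in B:b|_{L_i}\equiv0\}$. $\sigma_{\mathcal{L}}\subset\mathbb{R}^B$ is the cone whose relative interior consists of the $\omega\colon B\to\mathbb{R}$ constant on each $F_{i-1}\smallsetminus F_i$ with $\omega|_{F_i\smallsetminus F_{i+1}}>\omega|_{F_{i-1}\smallsetminus F_i}$ for $1\le i\le k$. $\mathscr{T}(B)\subset\mathbb{R}^B$ is the set of $\omega$ such that the matroid of bases of $B$ of maximal $\omega$-weight has no loops; it equals the tropical variety of $\mathcal{H}_B^c$. Its fine subdivision is the fan whose cones are the $\sigma_{\mathcal{L}}$ for flags of flats $\mathcal{L}$; its minimal cone, for the flag $\{0\}\subset V$, is $\mathbb{R}(1,\dots,1)$. For $1\le i\le k+1$ the forms in $F_{i-1}\smallsetminus F_i$ induce an arrangement in $L_i/L_{i-1}$; $((\mathcal{H}/L_{i-1})|_{L_i})^c\subset(\mathbb{C}^\times)^{F_{i-1}\smallsetminus F_i}$ is the image of its complement under $v\mapsto(\langle b,v\rangle)_{b\in F_{i-1}\smallsetminus F_i}$, and $\mathcal{H}(\mathcal{L})^c:=\prod_{i=1}^{k+1}((\mathcal{H}/L_{i-1})|_{L_i})^c\subset(\mathbb{C}^\times)^B$.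 Initial schemes: for $\omega\in\mathbb{Z}^B$, viewed as the cocharacter $t\mapsto(t^{\omega(b)})_b$, $\mathrm{in}_\omega X$ is the fiber over $0$ of the closure in $\mathbb{C}\times(\mathbb{C}^\times)^B$ of $\{(t,x)\in\mathbb{C}^\times\times(\mathbb{C}^\times)^B:\omega(t)\cdot x\in X\}$. For a cone $\sigma$ such that $\mathrm{in}_\omega X$ is the same for all integral $\omega$ in its relative interior, $\mathrm{in}_\sigma X$ is this common scheme, and $\mathscr{P}^\infty_\sigma(X):=\overline{c\mathscr{A}(\mathrm{in}_\sigma X)}$. The strata of the phase limit set $\mathscr{P}^\infty(\mathcal{H}_B^c)$ are the sets $\mathscr{P}^\infty_\sigma(\mathcal{H}_B^c)$ for $\sigma$ not the minimal cone. *)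

theory Defs
  imports "HOL-Analysis.Analysis" "HOL-Library.Poly_Mapping"
begin

text \<open>
  The finite multiset of linear forms is a family \<open>B\<close> indexed by a finite type \<open>'b\<close>, so that
  \<open>complex ^ 'b\<close> contains the torus and \<open>real ^ 'b\<close> contains the tropical variety.
\<close>

section \<open>The torus and coamoebas\<close>

definition torus :: "(complex ^ 'b::finite) set" where
  "torus = {x. \<forall>j. x $ j \<noteq> 0}"

definition arg_map :: "complex ^ 'b::finite \<Rightarrow> complex ^ 'b" where
  "arg_map x = (\<chi> j. x $ j / of_real (cmod (x $ j)))"

text \<open>Its closure in \<open>complex ^ 'b\<close> is its closure in the (compact) product of unit circles.\<close>

definition coamoeba :: "(complex ^ 'b::finite) set \<Rightarrow> (complex ^ 'b) set" where
  "coamoeba X = arg_map ` X"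


section \<open>Closed subschemes of the torus and initial schemes\<close>

text \<open>
  The coordinate ring of the torus is the group algebra of \<open>int ^ 'b\<close>, and that of
  (affine line) \<open>\<times>\<close> torus is the monoid algebra of \<open>nat \<times> int ^ 'b\<close>.  A closed subscheme of
  the torus is represented by its ideal, a set of Laurent polynomials.
\<close>

type_synonym 'b laurent = "(int ^ 'b) \<Rightarrow>\<^sub>0 complex"
type_synonym 'b line_laurent = "(nat \<times> (int ^ 'b)) \<Rightarrow>\<^sub>0 complex"

definition monomial_at :: "complex ^ 'b::finite \<Rightarrow> int ^ 'b \<Rightarrow> complex" where
  "monomial_at x m = (\<Prod>j\<in>UNIV. (x $ j) powi (m $ j))"

definition laurent_eval :: "'b::finite laurent \<Rightarrow> complex ^ 'b \<Rightarrow> complex" where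
  "laurent_eval f x = (\<Sum>m\<in>Poly_Mapping.keys f. Poly_Mapping.lookup f m * monomial_at x m)"

definition line_laurent_eval :: "'b::finite line_laurent \<Rightarrow> complex \<Rightarrow> complex ^ 'b \<Rightarrow> complex" where
  "line_laurent_eval f t x =
     (\<Sum>(n, m)\<in>Poly_Mapping.keys f. Poly_Mapping.lookup f (n, m) * t ^ n * monomial_at x m)"

definition vanishing_ideal :: "(complex ^ 'b::finite) set \<Rightarrow> 'b laurent set" where
  "vanishing_ideal X = {f. \<forall>x\<in>X. laurent_eval f x = 0}"

definition scheme_points :: "'b::finite laurent set \<Rightarrow> (complex ^ 'b) set" where
  "scheme_points I = {x\<in>torus. \<forall>f\<in>I. laurent_eval f x = 0}"

definition cocharacter_act :: "int ^ 'b::finite \<Rightarrow> complex \<Rightarrow> complex ^ 'b \<Rightarrow> complex ^ 'b" where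
  "cocharacter_act \<omega> t x = (\<chi> j. t powi (\<omega> $ j) * x $ j)"

definition degeneration :: "(complex ^ 'b::finite) set \<Rightarrow> int ^ 'b \<Rightarrow> (complex \<times> (complex ^ 'b)) set" where
  "degeneration X \<omega> = {(t, x). t \<noteq> 0 \<and> x \<in> torus \<and> cocharacter_act \<omega> t x \<in> X}"

text \<open>
  The ideal of the Zariski closure of the degeneration consists of the functions vanishing on it;
  the scheme-theoretic fiber over \<open>0\<close> is obtained by substituting \<open>t = 0\<close>, that is, by keeping
  only the coefficients of the monomials of degree \<open>0\<close> in \<open>t\<close>.
\<close>

definition closure_ideal :: "(complex \<times> (complex ^ 'b::finite)) set \<Rightarrow> 'b line_laurent set" where
  "closure_ideal Y = {f. \<forall>(t, x)\<in>Y. line_laurent_eval f t x = 0}"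

definition at_zero :: "'b::finite line_laurent \<Rightarrow> 'b laurent" where
  "at_zero f = Poly_Mapping.map_key (Pair 0) f"

definition initial_scheme :: "(complex ^ 'b::finite) set \<Rightarrow> int ^ 'b \<Rightarrow> 'b laurent set" where
  "initial_scheme X \<omega> = at_zero ` closure_ideal (degeneration X \<omega>)"

definition relint_lattice_points :: "(real ^ 'b::finite) set \<Rightarrow> (int ^ 'b) set" where
  "relint_lattice_points \<sigma> = {\<omega>. (\<chi> j. real_of_int (\<omega> $ j)) \<in> rel_interior \<sigma>}"

definition has_common_initial_scheme :: "(complex ^ 'b::finite) set \<Rightarrow> (real ^ 'b) set \<Rightarrow> bool" where
  "has_common_initial_scheme X \<sigma> \<longleftrightarrow> relint_lattice_points \<sigma> \<noteq> {} \<and>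
     (\<forall>\<omega>\<in>relint_lattice_points \<sigma>. \<forall>\<omega>'\<in>relint_lattice_points \<sigma>.
        initial_scheme X \<omega> = initial_scheme X \<omega>')"

text \<open>Meaningful only when \<^const>\<open>has_common_initial_scheme\<close> holds.\<close>

definition cone_initial_scheme :: "(complex ^ 'b::finite) set \<Rightarrow> (real ^ 'b) set \<Rightarrow> 'b laurent set" where
  "cone_initial_scheme X \<sigma> = (THE I. \<forall>\<omega>\<in>relint_lattice_points \<sigma>. initial_scheme X \<omega> = I)"

definition phase_limit_cone :: "(complex ^ 'b::finite) set \<Rightarrow> (real ^ 'b) set \<Rightarrow> (complex ^ 'b) set" where
  "phase_limit_cone X \<sigma> = closure (coamoeba (scheme_points (cone_initial_scheme X \<sigma>)))"


section \<open>Central arrangements and flags of flats\<close>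

definition arrangement_complement :: "('b::finite \<Rightarrow> 'v \<Rightarrow> complex) \<Rightarrow> (complex ^ 'b) set" where
  "arrangement_complement B = (\<lambda>v. \<chi> j. B j v) ` (UNIV - (\<Union>j. {v. B j v = 0}))"

definition flats :: "('b::finite \<Rightarrow> 'v \<Rightarrow> complex) \<Rightarrow> 'v set set" where
  "flats B = {\<Inter>j\<in>S. {v. B j v = 0} | S. True}"

text \<open>The flag \<open>L\<^sub>0 \<subset> \<dots> \<subset> L\<^bsub>k+1\<^esub>\<close> is the list \<open>L\<close> of length \<open>k + 2\<close> with \<open>L ! i = L\<^sub>i\<close>.\<close>

definition flag_of_flats :: "('b::finite \<Rightarrow> 'v::zero \<Rightarrow> complex) \<Rightarrow> 'v set list \<Rightarrow> bool" where
  "flag_of_flats B L \<longleftrightarrow> 2 \<le> length L \<and> hd L = {0} \<and> last L = UNIV \<and>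
     set L \<subseteq> flats B \<and> sorted_wrt (\<subset>) L"

definition trivial_flag :: "'v::zero set list" where
  "trivial_flag = [{0}, UNIV]"

definition flag_forms :: "('b::finite \<Rightarrow> 'v \<Rightarrow> complex) \<Rightarrow> 'v set list \<Rightarrow> nat \<Rightarrow> 'b set" where
  "flag_forms B L i = {j. \<forall>v\<in>L ! i. B j v = 0}"

definition flag_block :: "('b::finite \<Rightarrow> 'v \<Rightarrow> complex) \<Rightarrow> 'v set list \<Rightarrow> nat \<Rightarrow> 'b set" where
  "flag_block B L i = flag_forms B L (i - 1) - flag_forms B L i"

text \<open>In the following two definitions \<open>i < length L\<close> is \<open>i \<le> k + 1\<close> and \<open>i + 1 < length L\<close> is \<open>i \<le> k\<close>.\<close>

definition open_flag_cone :: "('b::finite \<Rightarrow> 'v \<Rightarrow> complex) \<Rightarrow> 'v set list \<Rightarrow> (real ^ 'b) set" where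
  "open_flag_cone B L = {\<omega>.
     (\<forall>i. 1 \<le> i \<and> i < length L \<longrightarrow>
        (\<forall>j\<in>flag_block B L i. \<forall>j'\<in>flag_block B L i. \<omega> $ j = \<omega> $ j')) \<and>
     (\<forall>i. 1 \<le> i \<and> i + 1 < length L \<longrightarrow>
        (\<forall>j\<in>flag_block B L (i + 1). \<forall>j'\<in>flag_block B L i. \<omega> $ j > \<omega> $ j'))}"

text \<open>
  Each factor of the product is the image of the complement of the arrangement induced in
  \<open>L\<^sub>i / L\<^bsub>i-1\<^esub>\<close>.  The forms of the \<open>i\<close>-th block vanish on \<open>L\<^bsub>i-1\<^esub>\<close>, so a point of the quotient
  may be replaced by a representative \<open>v \<in> L\<^sub>i\<close>; membership in the torus says that no form of the
  block vanishes at \<open>v\<close>.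
\<close>

definition flag_complement :: "('b::finite \<Rightarrow> 'v \<Rightarrow> complex) \<Rightarrow> 'v set list \<Rightarrow> (complex ^ 'b) set" where
  "flag_complement B L = {x\<in>torus. \<forall>i. 1 \<le> i \<and> i < length L \<longrightarrow>
     (\<exists>v\<in>L ! i. \<forall>j\<in>flag_block B L i. x $ j = B j v)}"

text \<open>The closed cone with relative interior \<^const>\<open>open_flag_cone\<close>.\<close>

definition flag_cone :: "('b::finite \<Rightarrow> 'v \<Rightarrow> complex) \<Rightarrow> 'v set list \<Rightarrow> (real ^ 'b) set" where
  "flag_cone B L = closure (open_flag_cone B L)"

text \<open>
  The fan of these cones is the fine subdivision of the set of all \<open>\<omega>\<close> for which the matroid of
  bases of \<open>B\<close> of maximal \<open>\<omega>\<close>-weight has no loops.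
\<close>

definition fine_subdivision :: "('b::finite \<Rightarrow> 'v::zero \<Rightarrow> complex) \<Rightarrow> (real ^ 'b) set set" where
  "fine_subdivision B = {flag_cone B L | L. flag_of_flats B L}"

text \<open>The excluded cone, the line spanned by \<open>(1, \<dots>, 1)\<close>, is the minimal cone of the fan.\<close>

definition phase_limit_strata :: "('b::finite \<Rightarrow> 'v::zero \<Rightarrow> complex) \<Rightarrow> (complex ^ 'b) set set" where
  "phase_limit_strata B =
     {phase_limit_cone (arrangement_complement B) \<sigma> | \<sigma>.
        \<sigma> \<in> fine_subdivision B \<and> \<sigma> \<noteq> range (\<lambda>c. \<chi> j. c)}"

end

theory Submission
  imports Defs
begin

text \<open>
  The complement of the arrangement is the part in the torus of the linear space
  \<open>{(B j v)\<^sub>j | v}\<close>.  Acting by the inverse of \<open>t\<^sup>\<omega>\<close> moves this linear space in a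
  family, and for \<open>\<omega>\<close> in the open cone of a flag the limit for \<open>t \<rightarrow> 0\<close> is the linear space \<open>flag_space\<close>, the image of
  \<open>\<Prod>\<^sub>i L\<^sub>i / L\<^bsub>i-1\<^esub>\<close>, whose part in the torus is the product \<open>flag_complement\<close> of the induced
  complements.  Two inclusions of ideals make this precise.  Each point of the product is the limit
  of a curve in the family whose vector in \<open>V\<close> has components in the flats, scaled by the powers of
  \<open>t\<close> that \<open>\<omega>\<close> prescribes (\<open>degeneration_curve\<close>), so the initial ideal vanishes on the product.
  Conversely, projections onto the flats combine into linear maps which depend polynomially on
  \<open>t\<close>, are the identity for \<open>t = 0\<close>, and carry the whole family into the limit space; pulling back
  along them lifts every equation of the limit to an equation of the family
  (\<open>vanishing_ideal_lift\<close>, \<open>vanishing_ideal_subset\<close>).  In particular the initial scheme is reduced,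
  and its points are those of the product.

  For the coamoebas, the curves with positive real \<open>t\<close> show that every phase of a product is a
  limit of phases of the arrangement complement.  Given conversely vectors of the complement whose
  phases converge, the forms are sorted by how fast their values decay, relative to each other,
  along subsequences.  The forms that decay faster than a given rate cut out a flat, these flats
  make up a flag, and the rescaled limits are the components of a point of the product for this
  flag with the limiting phases (\<open>limit_direction\<close>, \<open>limit_flag\<close>).
\<close>

section \<open>Laurent polynomials\<close>

lemma sum_keys_superset:
  fixes \<phi> :: "'k \<Rightarrow> complex"
  assumes "finite A" "Poly_Mapping.keys f \<subseteq> A"
  shows "(\<Sum>k\<in>Poly_Mapping.keys f. Poly_Mapping.lookup f k * \<phi> k) = (\<Sum>k\<in>A. Poly_Mapping.lookup f k * \<phi> k)"
  using assms by (intro sum.mono_neutral_left) (auto simp: in_keys_iff)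

lemma sum_keys_add:
  fixes \<phi> :: "'k \<Rightarrow> complex"
  shows "(\<Sum>k\<in>Poly_Mapping.keys (f + g). Poly_Mapping.lookup (f + g) k * \<phi> k) =
    (\<Sum>k\<in>Poly_Mapping.keys f. Poly_Mapping.lookup f k * \<phi> k) + (\<Sum>k\<in>Poly_Mapping.keys g. Poly_Mapping.lookup g k * \<phi> k)"
proof -
  let ?A = "Poly_Mapping.keys f \<union> Poly_Mapping.keys g"
  have "Poly_Mapping.keys (f + g) \<subseteq> ?A" by (rule Poly_Mapping.keys_add)
  then have "(\<Sum>k\<in>Poly_Mapping.keys (f + g). Poly_Mapping.lookup (f + g) k * \<phi> k) =
    (\<Sum>k\<in>?A. Poly_Mapping.lookup (f + g) k * \<phi> k)"
    by (intro sum_keys_superset) auto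
  then show ?thesis
    by (simp add: sum_keys_superset[of ?A f] sum_keys_superset[of ?A g] lookup_add distrib_right sum.distrib)
qed

text \<open>
  Bilinear identities need to be checked on monomials only; this makes multiplicativity of the
  evaluation and of \<^const>\<open>at_zero\<close> routine.
\<close>
lemma poly_mapping_additive_induct [case_names zero single add]:
  assumes "P 0" and "\<And>k a. P (Poly_Mapping.single k a)" and "\<And>f g. P f \<Longrightarrow> P g \<Longrightarrow> P (f + g)"
  shows "P (f :: 'k \<Rightarrow>\<^sub>0 'c::comm_monoid_add)"
proof (induction f rule: Poly_Mapping.update_induct)
  case (update f a b)
  have "Poly_Mapping.update a b f = f + Poly_Mapping.single a b"
    using update.hyps(1)
    by (intro poly_mapping_eqI) (auto simp: lookup_update lookup_add lookup_single when_def in_keys_iff)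
  then show ?case using assms update by simp
qed (rule assms)

lemma monomial_at_add: "x \<in> torus \<Longrightarrow> monomial_at x (m + m') = monomial_at x m * monomial_at x m'"
  by (simp add: monomial_at_def torus_def power_int_add prod.distrib)

lemma monomial_at_axis: "monomial_at x (axis j 1) = x $ j"
proof -
  have "monomial_at x (axis j 1) = (\<Prod>k\<in>UNIV. if k = j then x $ j else 1)"
    unfolding monomial_at_def by (intro prod.cong) (auto simp: axis_def)
  then show ?thesis by simp
qed

lemma monomial_at_0 [simp]: "monomial_at x 0 = 1"
  by (simp add: monomial_at_def)

lemma laurent_eval_add: "laurent_eval (f + g) x = laurent_eval f x + laurent_eval g x"
  unfolding laurent_eval_def by (rule sum_keys_add)

lemma laurent_eval_single: "laurent_eval (Poly_Mapping.single m c) x = c * monomial_at x m"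
  by (simp add: laurent_eval_def)

lemma laurent_eval_sum: "laurent_eval (sum f A) x = (\<Sum>a\<in>A. laurent_eval (f a) x)"
  by (induction A rule: infinite_finite_induct) (simp_all add: laurent_eval_add laurent_eval_def[of 0])

lemma line_laurent_eval_alt: "line_laurent_eval f t x =
  (\<Sum>k\<in>Poly_Mapping.keys f. Poly_Mapping.lookup f k * (t ^ fst k * monomial_at x (snd k)))"
  by (simp add: line_laurent_eval_def case_prod_unfold mult.assoc)

lemma line_laurent_eval_0: "line_laurent_eval 0 t x = 0"
  by (simp add: line_laurent_eval_def)

lemma line_laurent_eval_single: "line_laurent_eval (Poly_Mapping.single (n, m) c) t x = c * t ^ n * monomial_at x m"
  by (simp add: line_laurent_eval_def)

lemma line_laurent_eval_1: "line_laurent_eval 1 t x = 1"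
  using line_laurent_eval_single[of 0 0 1 t x] by (simp flip: single_one zero_prod_def)

lemma line_laurent_eval_add: "line_laurent_eval (f + g) t x = line_laurent_eval f t x + line_laurent_eval g t x"
  unfolding line_laurent_eval_alt by (rule sum_keys_add)

lemma line_laurent_eval_mult:
  assumes "x \<in> torus"
  shows "line_laurent_eval (f * g) t x = line_laurent_eval f t x * line_laurent_eval g t x"
proof (induction f rule: poly_mapping_additive_induct)
  case (single k a)
  show ?case
  proof (induction g rule: poly_mapping_additive_induct)
    case (single l b)
    obtain n m n' m' where "k = (n, m)" "l = (n', m')" by (metis surj_pair)
    then show ?case
      by (simp add: mult_single line_laurent_eval_single monomial_at_add[OF assms] power_add)
  qed (simp_all add: line_laurent_eval_0 line_laurent_eval_add algebra_simps)
qed (simp_all add: line_laurent_eval_0 line_laurent_eval_add algebra_simps)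

lemma line_laurent_eval_sum: "line_laurent_eval (sum f A) t x = (\<Sum>a\<in>A. line_laurent_eval (f a) t x)"
  by (induction A rule: infinite_finite_induct) (simp_all add: line_laurent_eval_add line_laurent_eval_0)

lemma line_laurent_eval_prod:
  "x \<in> torus \<Longrightarrow> line_laurent_eval (prod f A) t x = (\<Prod>a\<in>A. line_laurent_eval (f a) t x)"
  by (induction A rule: infinite_finite_induct) (simp_all add: line_laurent_eval_mult line_laurent_eval_1)

lemma line_laurent_eval_power:
  "x \<in> torus \<Longrightarrow> line_laurent_eval (f ^ n) t x = line_laurent_eval f t x ^ n"
  by (induction n) (simp_all add: line_laurent_eval_mult line_laurent_eval_1)

lemma inj_Pair_0: "inj (Pair 0)"
  by (simp add: inj_on_def)

lemma at_zero_0 [simp]: "at_zero 0 = 0"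
  by (simp add: at_zero_def map_key_zero[OF inj_Pair_0])

lemma at_zero_add: "at_zero (f + g) = at_zero f + at_zero g"
  by (simp add: at_zero_def map_key_plus[OF inj_Pair_0])

lemma lookup_at_zero: "Poly_Mapping.lookup (at_zero f) m = Poly_Mapping.lookup f (0, m)"
  by (simp add: at_zero_def map_key.rep_eq[OF inj_Pair_0])

lemma at_zero_single: "at_zero (Poly_Mapping.single (n, m) c) = (if n = 0 then Poly_Mapping.single m c else 0)"
  by (intro poly_mapping_eqI) (auto simp: lookup_at_zero lookup_single when_def)

lemma at_zero_1 [simp]: "at_zero 1 = 1"
  using at_zero_single[of 0 0 1] by (simp flip: single_one zero_prod_def)

text \<open>
  Setting \<open>t = 0\<close> is a ring homomorphism because exponents of \<open>t\<close> are natural numbers: they add up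
  to \<open>0\<close> only if both are \<open>0\<close>.
\<close>
lemma at_zero_mult: "at_zero (f * g) = at_zero f * at_zero g"
proof (induction f rule: poly_mapping_additive_induct)
  case (single k a)
  show ?case
  proof (induction g rule: poly_mapping_additive_induct)
    case (single l b)
    obtain n m n' m' where "k = (n, m)" "l = (n', m')" by (metis surj_pair)
    then show ?case by (simp add: mult_single at_zero_single)
  qed (simp_all add: at_zero_add algebra_simps)
qed (simp_all add: at_zero_add algebra_simps)

lemma at_zero_sum: "at_zero (sum f A) = (\<Sum>a\<in>A. at_zero (f a))"
  by (induction A rule: infinite_finite_induct) (simp_all add: at_zero_add)

lemma at_zero_prod: "at_zero (prod f A) = (\<Prod>a\<in>A. at_zero (f a))"
  by (induction A rule: infinite_finite_induct) (simp_all add: at_zero_mult)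

lemma at_zero_power: "at_zero (f ^ n) = at_zero f ^ n"
  by (induction n) (simp_all add: at_zero_mult)

lemma line_laurent_eval_at_zero: "line_laurent_eval f 0 x = laurent_eval (at_zero f) x"
proof (induction f rule: poly_mapping_additive_induct)
  case (single k a)
  obtain n m where "k = (n, m)" by (metis surj_pair)
  then show ?case by (simp add: line_laurent_eval_single at_zero_single laurent_eval_single laurent_eval_def[of 0])
qed (simp_all add: line_laurent_eval_0 line_laurent_eval_add laurent_eval_add at_zero_add laurent_eval_def[of 0])

lemma tendsto_line_laurent_eval:
  assumes "(y \<longlongrightarrow> x) (at 0)" "x \<in> torus"
  shows "((\<lambda>t. line_laurent_eval f t (y t)) \<longlongrightarrow> line_laurent_eval f 0 x) (at 0)"
  unfolding line_laurent_eval_alt monomial_at_def using assms(2)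
  by (intro tendsto_intros tendsto_power_int tendsto_vec_nth assms(1)) (auto simp: torus_def)

lemma prod_single_power:
  "(\<Prod>j\<in>UNIV. Poly_Mapping.single (axis j 1) (1::complex) ^ k j) =
    Poly_Mapping.single (\<chi> j. int (k j) :: int ^ 'b::finite) 1"
proof -
  have pow: "Poly_Mapping.single (axis j 1) (1::complex) ^ n = Poly_Mapping.single (axis j (int n) :: int ^ 'b) 1" for j n
  proof (induction n)
    case 0
    have "axis j (int 0) = (0 :: int ^ 'b)" by (simp add: axis_def vec_eq_iff)
    then show ?case by (simp only: power_0 single_one)
  next
    case (Suc n)
    have "axis j 1 + axis j (int n) = (axis j (1 + int n) :: int ^ 'b)" by (auto simp: axis_def vec_eq_iff)
    with Suc show ?case by (simp add: mult_single)
  qed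
  have prod: "(\<Prod>j\<in>J. Poly_Mapping.single (axis j (int (k j)) :: int ^ 'b) (1::complex)) =
    Poly_Mapping.single (\<Sum>j\<in>J. axis j (int (k j))) 1" for J
    by (induction J rule: infinite_finite_induct) (simp_all add: mult_single)
  have "(\<Sum>j\<in>UNIV. axis j (int (k j))) = (\<chi> j. int (k j) :: int ^ 'b)"
    by (simp add: vec_eq_iff axis_def sum.delta')
  then show ?thesis by (simp add: pow prod)
qed

text \<open>
  This is the flatness argument for the initial ideal, in explicit form.  The maps \<open>\<rho> t\<close> are
  linear, polynomial in \<open>t\<close>, the identity at \<open>t = 0\<close>, and they carry the fibers of \<open>Y\<close> into the
  linear space \<open>W\<close>.  Pulling an equation \<open>g\<close> of \<open>W\<close> back along \<open>\<rho>\<close> therefore gives a function that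
  vanishes on \<open>Y\<close> and restricts to \<open>g\<close> at \<open>t = 0\<close>.  Since \<open>\<rho> t\<close> does not preserve the torus, \<open>g\<close> is
  first multiplied by a monomial to become a polynomial; this polynomial vanishes on all of \<open>W\<close>
  because \<open>torus \<inter> W\<close> is dense in \<open>W\<close>.
\<close>
lemma vanishing_ideal_lift:
  fixes D :: "'b::finite \<Rightarrow> 'b \<Rightarrow> complex" and e :: "'b \<Rightarrow> 'b \<Rightarrow> nat" and W :: "(complex ^ 'b) set"
  defines "\<rho> \<equiv> \<lambda>t x. \<chi> j. x $ j - (\<Sum>m\<in>UNIV. D j m * t ^ e j m * x $ m)"
  assumes e: "\<And>j m. D j m \<noteq> 0 \<Longrightarrow> 0 < e j m"
    and W: "vec.subspace W" and y0: "y\<^sub>0 \<in> torus \<inter> W"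
    and g: "g \<in> vanishing_ideal (torus \<inter> W)"
    and Y: "\<And>t x. (t, x) \<in> Y \<Longrightarrow> x \<in> torus \<and> \<rho> t x \<in> W"
  shows "g \<in> at_zero ` closure_ideal Y"
proof -
  let ?K = "Poly_Mapping.keys g" and ?c = "Poly_Mapping.lookup g"
  (* Any upper bound for the absolute values of the exponents of g will do. *)
  define N where "N = (\<Sum>m\<in>?K. \<Sum>j\<in>UNIV. \<bar>m $ j\<bar>)"
  have N: "0 \<le> m $ j + N" if "m \<in> ?K" for m j
  proof -
    have "\<bar>m $ j\<bar> \<le> (\<Sum>j\<in>UNIV. \<bar>m $ j\<bar>)" by (rule member_le_sum) auto
    also have "\<dots> \<le> N" unfolding N_def using that
      by (intro member_le_sum[of m ?K "\<lambda>m. \<Sum>j\<in>UNIV. \<bar>m $ j\<bar>"]) (auto intro: sum_nonneg)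
    finally show ?thesis by linarith
  qed
  define M where "M = (\<chi> j. - N :: int ^ 'b)"
  define p where "p y = (\<Sum>m\<in>?K. ?c m * (\<Prod>j\<in>UNIV. y $ j ^ nat (m $ j + N)))" for y :: "complex ^ 'b"
  define R :: "'b \<Rightarrow> 'b line_laurent" where "R j = Poly_Mapping.single (0, axis j 1) 1 +
    (\<Sum>m\<in>UNIV. Poly_Mapping.single (e j m, axis m 1) (- D j m))" for j
  define f where "f = (\<Sum>m\<in>?K. Poly_Mapping.single (0, M) (?c m) * (\<Prod>j\<in>UNIV. R j ^ nat (m $ j + N)))"

  have p_torus: "p y = 0" if "y \<in> torus \<inter> W" for y
  proof -
    have "(\<Prod>j\<in>UNIV. y $ j ^ nat (m $ j + N)) = monomial_at y m * monomial_at y (- M)" if "m \<in> ?K" for m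
    proof -
      have "(\<Prod>j\<in>UNIV. y $ j ^ nat (m $ j + N)) = monomial_at y (m - M)"
        unfolding monomial_at_def M_def using N[OF that]
        by (intro prod.cong) (auto simp: power_int_def nat_add_distrib)
      then show ?thesis using monomial_at_add[of y m "- M"] \<open>y \<in> torus \<inter> W\<close> by simp
    qed
    then have "p y = laurent_eval g y * monomial_at y (- M)"
      by (simp add: p_def laurent_eval_def sum_distrib_right mult.assoc)
    with g that show ?thesis by (simp add: vanishing_ideal_def)
  qed
  have p_W: "p y = 0" if "y \<in> W" for y
  proof -
    (* The line through y in the direction of a torus point leaves the coordinate hyperplanes
       immediately, so y is a limit of points of the torus in W. *)
    define z where "z s = y + s *s y\<^sub>0" for s :: complex
    have zj: "z s $ j = y $ j + s * y\<^sub>0 $ j" for s j by (simp add: z_def)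
    have "((\<lambda>s. p (z s)) \<longlongrightarrow> p (z 0)) (at 0)"
      unfolding p_def zj by (intro tendsto_intros)
    moreover have "\<forall>\<^sub>F s in at 0. p (z s) = 0"
    proof -
      have "\<forall>\<^sub>F s in at 0. z s $ j \<noteq> 0" for j
      proof -
        have y0j: "y\<^sub>0 $ j \<noteq> 0" using y0 by (simp add: torus_def)
        have "\<forall>\<^sub>F s in at (0::complex). s \<noteq> - y $ j / y\<^sub>0 $ j"
          by (rule eventually_neq_at_within)
        then show ?thesis
          by eventually_elim (use y0j in \<open>auto simp: zj field_simps eq_neg_iff_add_eq_0\<close>)
      qed
      then have "\<forall>\<^sub>F s in at 0. \<forall>j. z s $ j \<noteq> 0" by (simp add: eventually_all_finite)
      then show ?thesis
      proof eventually_elim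
        case (elim s)
        have "z s \<in> W" unfolding z_def using W that y0
          by (auto intro: vec.subspace_add vec.subspace_scale)
        with elim show ?case by (intro p_torus) (simp add: torus_def)
      qed
    qed
    ultimately have "((\<lambda>s. 0) \<longlongrightarrow> p (z 0)) (at (0::complex))"
      by (auto elim: Lim_transform_eventually)
    then have "p (z 0) = 0" by (rule LIM_unique[OF _ tendsto_const])
    then show ?thesis by (simp add: z_def)
  qed

  have f_eval: "line_laurent_eval f t x = monomial_at x M * p (\<rho> t x)" if "x \<in> torus" for t x
  proof -
    have "line_laurent_eval (R j) t x = \<rho> t x $ j" for j
      by (simp add: R_def line_laurent_eval_add line_laurent_eval_sum line_laurent_eval_single
          monomial_at_axis \<rho>_def sum_negf)
    then show ?thesis using that
      by (simp add: f_def p_def line_laurent_eval_sum line_laurent_eval_mult line_laurent_eval_prod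
          line_laurent_eval_power line_laurent_eval_single sum_distrib_left mult_ac)
  qed
  have "f \<in> closure_ideal Y"
    using Y by (auto simp: closure_ideal_def f_eval p_W)
  moreover have "at_zero f = g"
  proof -
    have "at_zero (R j) = Poly_Mapping.single (axis j 1) 1" for j
    proof -
      have "at_zero (Poly_Mapping.single (e j m, axis m 1) (- D j m)) = 0" for m
        using e[of j m] by (cases "D j m = 0") (simp_all add: at_zero_single)
      then show ?thesis by (simp add: R_def at_zero_add at_zero_sum at_zero_single)
    qed
    then have "at_zero f = (\<Sum>m\<in>?K. Poly_Mapping.single M (?c m) * Poly_Mapping.single (\<chi> j. int (nat (m $ j + N))) 1)"
      by (simp add: f_def at_zero_sum at_zero_mult at_zero_prod at_zero_power at_zero_single prod_single_power)
    also have "\<dots> = (\<Sum>m\<in>?K. Poly_Mapping.single m (?c m))"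
    proof (intro sum.cong refl)
      fix m assume "m \<in> ?K"
      then have "M + (\<chi> j. int (nat (m $ j + N))) = m" using N by (simp add: vec_eq_iff M_def)
      then show "Poly_Mapping.single M (?c m) * Poly_Mapping.single (\<chi> j. int (nat (m $ j + N))) 1 =
        Poly_Mapping.single m (?c m)"
        by (simp add: mult_single)
    qed
    also have "\<dots> = g"
      by (intro poly_mapping_eqI) (simp add: lookup_sum lookup_single when_def in_keys_iff)
    finally show ?thesis .
  qed
  ultimately show ?thesis by blast
qed

lemma eventually_torus:
  assumes "(y \<longlongrightarrow> x) F" "x \<in> torus"
  shows "\<forall>\<^sub>F t in F. y t \<in> torus"
proof -
  have "\<forall>\<^sub>F t in F. y t $ j \<noteq> 0" for j
    using tendsto_imp_eventually_ne[OF tendsto_vec_nth[OF assms(1)]] assms(2) by (simp add: torus_def)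
  then show ?thesis by (simp add: torus_def eventually_all_finite)
qed

text \<open>
  A point of the torus outside \<open>W\<close> is separated from \<open>W\<close> by a linear form, namely by a coordinate of
  \<open>y \<mapsto> y - p y\<close> for a linear projection \<open>p\<close> onto \<open>W\<close>, and linear forms are Laurent polynomials.
\<close>
lemma scheme_points_vanishing_ideal_subspace:
  fixes W :: "(complex ^ 'b::finite) set"
  assumes "vec.subspace W"
  shows "scheme_points (vanishing_ideal (torus \<inter> W)) = torus \<inter> W"
proof (intro set_eqI iffI)
  fix x assume "x \<in> torus \<inter> W"
  then show "x \<in> scheme_points (vanishing_ideal (torus \<inter> W))"
    by (simp add: scheme_points_def vanishing_ideal_def)
next
  fix x assume x: "x \<in> scheme_points (vanishing_ideal (torus \<inter> W))"
  have "inj_on (\<lambda>y :: complex ^ 'b. y) W" by simp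
  moreover have "Vector_Spaces.linear (*s) (*s) (\<lambda>y :: complex ^ 'b. y)" by unfold_locales auto
  ultimately obtain p :: "complex ^ 'b \<Rightarrow> complex ^ 'b"
    where pW: "range p \<subseteq> W" and p: "Vector_Spaces.linear (*s) (*s) p" and p_id: "\<And>y. y \<in> W \<Longrightarrow> p y = y"
    using vec.linear_exists_left_inverse_on[of "\<lambda>y. y" W] assms by blast
  interpret p: Vector_Spaces.linear "(*s)" "(*s)" p by (rule p)
  have "x $ j - p x $ j = 0" for j
  proof -
    define f where "f = (\<Sum>m\<in>UNIV. Poly_Mapping.single (axis m 1 :: int ^ 'b) ((if m = j then 1 else 0) - p (axis m 1) $ j))"
    have f: "laurent_eval f y = y $ j - p y $ j" for y
    proof -
      have "y = (\<Sum>m\<in>UNIV. y $ m *s axis m 1)"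
        by (simp add: vec_eq_iff axis_def if_distrib cong: if_cong)
      then have "p y = p (\<Sum>m\<in>UNIV. y $ m *s axis m 1)" by simp
      then have "p y $ j = (\<Sum>m\<in>UNIV. y $ m * p (axis m 1) $ j)" by (simp add: p.sum p.scale)
      then show ?thesis
        by (simp add: f_def laurent_eval_sum laurent_eval_single monomial_at_axis left_diff_distrib sum_subtractf
            if_distrib[of "\<lambda>c. c * _"] mult.commute[of "p _ $ _"] cong: if_cong)
    qed
    have "f \<in> vanishing_ideal (torus \<inter> W)" by (simp add: vanishing_ideal_def f p_id)
    then have "laurent_eval f x = 0" using x by (simp add: scheme_points_def)
    then show ?thesis by (simp add: f)
  qed
  then have "x = p x" by (simp add: vec_eq_iff)
  then have "x \<in> W" using pW by (metis rangeI subsetD)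
  then show "x \<in> torus \<inter> W" using x by (simp add: scheme_points_def)
qed

section \<open>Families of linear forms\<close>

text \<open>
  Forms that span the dual space separate points: for them the origin is the smallest flat, and
  \<open>v \<mapsto> (B j v)\<^sub>j\<close> is a linear embedding.
\<close>
locale separating_forms = vector_space scale
  for scale :: "complex \<Rightarrow> 'v::ab_group_add \<Rightarrow> 'v" +
  fixes B :: "'b::finite \<Rightarrow> 'v \<Rightarrow> complex"
  assumes linear_form: "Vector_Spaces.linear scale (*) (B j)"
    and form_nonzero: "\<exists>v. B j v \<noteq> 0"
    and separating: "(\<And>j. B j v = 0) \<Longrightarrow> v = 0"
begin

lemma form_add: "B j (v + w) = B j v + B j w"
  and form_scale: "B j (scale c v) = c * B j v"
proof -
  interpret Vector_Spaces.linear scale "(*)" "B j" by (rule linear_form)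
  show "B j (v + w) = B j v + B j w" and "B j (scale c v) = c * B j v"
    by (rule add, rule scale)
qed

lemma form_0 [simp]: "B j 0 = 0"
  using form_scale[of j 0 0] by simp

lemma form_diff: "B j (v - w) = B j v - B j w"
  using form_add[of j "v - w" w] by simp

lemma form_sum: "B j (sum f A) = (\<Sum>a\<in>A. B j (f a))"
  by (induction A rule: infinite_finite_induct) (simp_all add: form_add)

lemma arrangement_complement_eq: "arrangement_complement B = torus \<inter> range (\<lambda>v. \<chi> j. B j v)"
  by (auto simp: arrangement_complement_def torus_def)

definition common_kernel :: "'b set \<Rightarrow> 'v set" where
  "common_kernel F = {v. \<forall>j\<in>F. B j v = 0}"

lemma flats_eq: "flats B = range common_kernel"
  by (auto simp: flats_def common_kernel_def)

text \<open>
  This is the statement that a linear form vanishing on \<open>common_kernel F\<close> is a combination of the forms in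
  \<open>F\<close>, for all the forms \<open>B j \<circ> (id - P)\<close> at once, with \<open>P\<close> a linear projection onto \<open>common_kernel F\<close>.
  If \<open>h\<close> is a partial inverse of \<open>T = (B m)\<^bsub>m \<in> F\<^esub>\<close>, then \<open>v - h (T v)\<close> lies in the kernel of \<open>T\<close>, and
  \<open>B j (h (T v))\<close> is a linear function of \<open>T v\<close>.
\<close>
lemma kernel_projection:
  obtains P D where "\<And>v. P v \<in> common_kernel F"
    and "\<And>v j. B j (P v) = B j v - (\<Sum>m\<in>F. D j m * B m v)"
proof -
  interpret pair: vector_space_pair scale "(*s) :: complex \<Rightarrow> complex ^ 'b \<Rightarrow> complex ^ 'b"
    by unfold_locales
  define T where "T v = (\<chi> j. if j \<in> F then B j v else 0)" for v
  have T: "Vector_Spaces.linear scale (*s) T"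
    by unfold_locales (auto simp: T_def vec_eq_iff form_add form_scale)
  obtain h where h: "Vector_Spaces.linear (*s) scale h" and Th: "T (h (T v)) = T v" for v
    using pair.linear_exists_right_inverse_on[OF T subspace_UNIV] by auto
  interpret h: Vector_Spaces.linear "(*s)" scale h by (rule h)
  define D where "D j m = B j (h (axis m 1))" for j m
  have Bh: "B j (h y) = (\<Sum>m\<in>UNIV. D j m * y $ m)" for j y
  proof -
    have "y = (\<Sum>m\<in>UNIV. y $ m *s axis m 1)"
      by (simp add: vec_eq_iff axis_def if_distrib cong: if_cong)
    then have "B j (h y) = B j (h (\<Sum>m\<in>UNIV. y $ m *s axis m 1))" by simp
    then show ?thesis by (simp add: h.sum h.scale form_sum form_scale D_def mult.commute)
  qed
  show thesis
  proof (rule that[of "\<lambda>v. v - h (T v)" D])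
    fix v
    show "v - h (T v) \<in> common_kernel F"
      using Th[of v] by (auto simp: common_kernel_def form_diff T_def vec_eq_iff dest!: bspec split: if_splits)
    fix j
    have "(\<Sum>m\<in>UNIV. D j m * T v $ m) = (\<Sum>m\<in>F. D j m * B m v)"
      by (simp add: T_def if_distrib sum.If_cases cong: if_cong)
    then show "B j (v - h (T v)) = B j v - (\<Sum>m\<in>F. D j m * B m v)"
      by (simp add: form_diff Bh)
  qed
qed

text \<open>A vector space over an infinite field is not a finite union of proper subspaces.\<close>
lemma generic_vector:
  assumes "finite J" "subspace V" "\<And>j. j \<in> J \<Longrightarrow> \<exists>v\<in>V. B j v \<noteq> 0"
  shows "\<exists>v\<in>V. \<forall>j\<in>J. B j v \<noteq> 0"
  using assms(1,3)
proof (induction J)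
  case empty
  then show ?case using assms(2) subspace_0 by blast
next
  case (insert i J)
  obtain v where v: "v \<in> V" "\<forall>j\<in>J. B j v \<noteq> 0" using insert by auto
  obtain u where u: "u \<in> V" "B i u \<noteq> 0" using insert.prems by auto
  have "finite ((\<lambda>j. - B j u / B j v) ` insert i J)" using insert.hyps by simp
  then obtain s where s: "s \<notin> (\<lambda>j. - B j u / B j v) ` insert i J"
    using ex_new_if_finite[OF infinite_UNIV_char_0] by blast
  have "B j (u + scale s v) \<noteq> 0" if "j \<in> insert i J" for j
  proof (cases "B j v = 0")
    case True
    with that v u show ?thesis by (auto simp: form_add form_scale)
  next
    case False
    have "B j u + s * B j v \<noteq> 0"
    proof
      assume "B j u + s * B j v = 0"
      then have "s * B j v = - B j u" by (simp add: eq_neg_iff_add_eq_0 add.commute)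
      then have "s = - B j u / B j v" using False by (metis nonzero_mult_div_cancel_right)
      then show False using s that by blast
    qed
    then show ?thesis by (simp add: form_add form_scale)
  qed
  moreover have "u + scale s v \<in> V" using assms(2) u v by (auto intro: subspace_add subspace_scale)
  ultimately show ?case by blast
qed

end

section \<open>Flags of flats and their cones\<close>

locale flag = separating_forms scale B
  for scale :: "complex \<Rightarrow> 'v::ab_group_add \<Rightarrow> 'v" and B :: "'b::finite \<Rightarrow> 'v \<Rightarrow> complex" +
  fixes L :: "'v set list"
  assumes flag: "flag_of_flats B L"
begin

lemma length_ge: "2 \<le> length L"
  using flag by (simp add: flag_of_flats_def)

lemma L_0: "L ! 0 = {0}"
  using flag length_ge by (cases L) (auto simp: flag_of_flats_def)

lemma L_last: "L ! (length L - 1) = UNIV"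
proof -
  have "L \<noteq> []" using length_ge by auto
  then show ?thesis using flag last_conv_nth[of L] by (simp add: flag_of_flats_def)
qed

lemma not_in_last_forms: "j \<notin> flag_forms B L (length L - 1)"
  using form_nonzero[of j] L_last by (simp add: flag_forms_def)

lemma L_strict: "i < i' \<Longrightarrow> i' < length L \<Longrightarrow> L ! i \<subset> L ! i'"
  using flag by (auto simp: flag_of_flats_def sorted_wrt_iff_nth_less)

lemma L_mono: "i \<le> i' \<Longrightarrow> i' < length L \<Longrightarrow> L ! i \<subseteq> L ! i'"
  using L_strict[of i i'] by (cases "i = i'") auto

lemma L_kernel:
  assumes "i < length L"
  shows "L ! i = common_kernel (flag_forms B L i)"
proof -
  have "L ! i \<in> range common_kernel"
    using flag nth_mem[OF assms] unfolding flag_of_flats_def flats_eq by blast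
  then obtain S where S: "L ! i = common_kernel S" by blast
  then have "S \<subseteq> flag_forms B L i" by (auto simp: flag_forms_def common_kernel_def)
  with S show ?thesis by (auto simp: flag_forms_def common_kernel_def)
qed

lemma subspace_L: "i < length L \<Longrightarrow> subspace (L ! i)"
  by (simp add: L_kernel common_kernel_def subspace_def form_add form_scale)

lemma forms_antimono: "i \<le> i' \<Longrightarrow> i' < length L \<Longrightarrow> flag_forms B L i' \<subseteq> flag_forms B L i"
  using L_mono[of i i'] by (auto simp: flag_forms_def)

text \<open>
  The index sets of the forms vanishing on the flats of the flag decrease from everything to the
  empty set, so their successive differences partition the forms; \<open>level j\<close> is the number of the
  block that contains \<open>j\<close>.
\<close>
definition level :: "'b \<Rightarrow> nat" where
  "level j = (LEAST i. j \<notin> flag_forms B L i)"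

lemma forms_iff_level:
  assumes "i < length L"
  shows "j \<in> flag_forms B L i \<longleftrightarrow> i < level j"
proof
  assume "i < level j"
  then show "j \<in> flag_forms B L i" unfolding level_def using not_less_Least by blast
next
  assume j: "j \<in> flag_forms B L i"
  have "j \<notin> flag_forms B L (level j)" unfolding level_def
    by (rule LeastI[where P = "\<lambda>i. j \<notin> flag_forms B L i", OF not_in_last_forms])
  then show "i < level j" using forms_antimono[of "level j" i] j assms by (meson not_le subsetD)
qed

lemma level_pos: "1 \<le> level j"
proof -
  have "j \<in> flag_forms B L 0" by (simp add: flag_forms_def L_0)
  then show ?thesis using forms_iff_level[of 0 j] length_ge by linarith
qed

lemma level_less: "level j < length L"
proof -
  have "length L - 1 < length L" using length_ge by linarith
  then have "\<not> length L - 1 < level j" using forms_iff_level not_in_last_forms by blast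
  then show ?thesis using length_ge by linarith
qed

lemma block_iff_level: "1 \<le> i \<Longrightarrow> i < length L \<Longrightarrow> j \<in> flag_block B L i \<longleftrightarrow> level j = i"
  by (auto simp: flag_block_def forms_iff_level)

lemma form_vanishes_below: "v \<in> L ! i \<Longrightarrow> i < level j \<Longrightarrow> B j v = 0"
  using forms_iff_level[of i j] level_less[of j] by (auto simp: flag_forms_def)

text \<open>A flat is determined by the forms that vanish on it, so the blocks of a strict flag are not empty.\<close>
lemma ex_level: "1 \<le> i \<Longrightarrow> i < length L \<Longrightarrow> \<exists>j. level j = i"
proof (rule ccontr)
  assume i: "1 \<le> i" "i < length L" and "\<nexists>j. level j = i"
  then have "i - 1 < level j \<longleftrightarrow> i < level j" for j
    by (cases "level j" i rule: linorder_cases) auto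
  then have "flag_forms B L (i - 1) = flag_forms B L i"
    using i by (simp add: set_eq_iff forms_iff_level)
  then show False using L_kernel[of i] L_kernel[of "i - 1"] L_strict[of "i - 1" i] i by auto
qed

text \<open>
  The defining inequalities compare consecutive blocks only; as no block is empty, they can be chained.
\<close>
lemma open_flag_cone_eq:
  "open_flag_cone B L = {\<omega>. \<forall>j j'. (level j = level j' \<longrightarrow> \<omega> $ j = \<omega> $ j') \<and> (level j < level j' \<longrightarrow> \<omega> $ j < \<omega> $ j')}"
  (is "_ = ?C")
proof (intro set_eqI iffI)
  fix \<omega> assume \<omega>: "\<omega> \<in> open_flag_cone B L"
  have eq: "\<omega> $ j = \<omega> $ j'" if "level j = level j'" for j j'
  proof -
    have "j \<in> flag_block B L (level j)" "j' \<in> flag_block B L (level j)"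
      using that level_pos[of j] level_less[of j] by (simp_all add: block_iff_level)
    then show ?thesis using \<omega> level_pos[of j] level_less[of j] unfolding open_flag_cone_def by blast
  qed
  have step: "\<omega> $ j < \<omega> $ j'" if "level j' = level j + 1" for j j'
  proof -
    have "level j + 1 < length L" using level_less[of j'] that by simp
    moreover from this have "j \<in> flag_block B L (level j)" "j' \<in> flag_block B L (level j + 1)"
      using that level_pos[of j] by (simp_all add: block_iff_level)
    ultimately show ?thesis using \<omega> level_pos[of j] unfolding open_flag_cone_def by blast
  qed
  have less: "\<omega> $ j < \<omega> $ j'" if "level j' = level j + Suc d" for j j' d
    using that
  proof (induction d arbitrary: j')
    case 0
    then show ?case using step by simp
  next
    case (Suc d)
    then have "1 \<le> level j + Suc d" "level j + Suc d < length L" using level_less[of j'] by auto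
    then obtain k where k: "level k = level j + Suc d" using ex_level by blast
    then have "\<omega> $ j < \<omega> $ k" using Suc by simp
    also have "\<omega> $ k < \<omega> $ j'" using k Suc.prems step by simp
    finally show ?case .
  qed
  have "\<omega> $ j < \<omega> $ j'" if "level j < level j'" for j j'
    using less[of j' j "level j' - level j - 1"] that by simp
  with eq show "\<omega> \<in> ?C" by blast
next
  fix \<omega> assume \<omega>: "\<omega> \<in> ?C"
  show "\<omega> \<in> open_flag_cone B L"
    unfolding open_flag_cone_def
  proof (intro CollectI conjI allI impI ballI)
    fix i j j' assume "1 \<le> i \<and> i < length L" "j \<in> flag_block B L i" "j' \<in> flag_block B L i"
    then have "level j = level j'" by (simp add: block_iff_level)
    then show "\<omega> $ j = \<omega> $ j'" using \<omega> by blast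
  next
    fix i j j' assume "1 \<le> i \<and> i + 1 < length L" "j \<in> flag_block B L (i + 1)" "j' \<in> flag_block B L i"
    then have "level j' < level j" by (simp add: block_iff_level)
    then show "\<omega> $ j > \<omega> $ j'" using \<omega> by blast
  qed
qed

text \<open>
  The cone is the intersection of a linear subspace with a convex open set, hence relatively open
  and convex, and a convex set has the same relative interior as its closure.
\<close>
lemma rel_interior_flag_cone: "rel_interior (flag_cone B L) = open_flag_cone B L"
proof -
  define W where "W = {\<omega> :: real ^ 'b. \<forall>j j'. level j = level j' \<longrightarrow> \<omega> $ j = \<omega> $ j'}"
  define U where "U = (\<Inter>(j, j')\<in>{(j, j'). level j < level j'}. {\<omega> :: real ^ 'b. \<omega> $ j < \<omega> $ j'})"
  have WU: "open_flag_cone B L = W \<inter> U"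
    unfolding open_flag_cone_eq W_def U_def by blast
  have "affine W"
    unfolding affine_def
  proof (intro ballI allI impI)
    fix \<omega> \<omega>' and a b :: real assume "\<omega> \<in> W" "\<omega>' \<in> W"
    then have *: "\<omega> $ j = \<omega> $ j'" "\<omega>' $ j = \<omega>' $ j'" if "level j = level j'" for j j'
      using that unfolding W_def by blast+
    show "a *\<^sub>R \<omega> + b *\<^sub>R \<omega>' \<in> W"
      unfolding W_def
    proof (intro CollectI allI impI)
      fix j j' assume "level j = level j'"
      then show "(a *\<^sub>R \<omega> + b *\<^sub>R \<omega>') $ j = (a *\<^sub>R \<omega> + b *\<^sub>R \<omega>') $ j'"
        by (simp only: vector_add_component vector_scaleR_component *[of j j'])
    qed
  qed
  have "open U" unfolding U_def
    by (intro open_INT) (auto intro!: open_Collect_less continuous_intros)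
  have "convex U" unfolding U_def
  proof (intro convex_INT, clarify)
    fix j j'
    have "{\<omega> :: real ^ 'b. \<omega> $ j < \<omega> $ j'} = {\<omega>. inner (axis j 1 - axis j' 1) \<omega> < 0}"
      by (auto simp: inner_diff_left inner_axis')
    then show "convex {\<omega> :: real ^ 'b. \<omega> $ j < \<omega> $ j'}" by (simp add: convex_halfspace_lt)
  qed
  have "affine hull (W \<inter> U) \<subseteq> W" using \<open>affine W\<close> by (intro hull_minimal) auto
  then have "W \<inter> U = affine hull (W \<inter> U) \<inter> U"
    using hull_subset[of "W \<inter> U" affine] by blast
  then have "openin (top_of_set (affine hull (W \<inter> U))) (W \<inter> U)"
    using \<open>open U\<close> by (metis openin_open_Int)
  then have "rel_interior (W \<inter> U) = W \<inter> U" by (rule rel_interior_openin)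
  moreover have "convex (W \<inter> U)" using \<open>affine W\<close> \<open>convex U\<close> by (simp add: affine_imp_convex convex_Int)
  ultimately show ?thesis by (simp add: flag_cone_def WU convex_rel_interior_closure)
qed

lemma relint_lattice_points_flag_cone:
  "relint_lattice_points (flag_cone B L) =
    {\<omega>. \<forall>j j'. (level j = level j' \<longrightarrow> \<omega> $ j = \<omega> $ j') \<and> (level j < level j' \<longrightarrow> \<omega> $ j < \<omega> $ j')}"
  by (simp add: relint_lattice_points_def rel_interior_flag_cone open_flag_cone_eq)

lemma level_lattice_point: "(\<chi> j. int (level j)) \<in> relint_lattice_points (flag_cone B L)"
  by (simp add: relint_lattice_points_flag_cone)

text \<open>A flag with an intermediate flat has at least two blocks, and \<open>\<omega>\<close> separates them.\<close>
lemma flag_cone_eq_line: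
  assumes "flag_cone B L = range (\<lambda>c. \<chi> j. c)"
  shows "L = trivial_flag"
proof -
  have "(\<chi> j. real (level j)) \<in> open_flag_cone B L" by (simp add: open_flag_cone_eq)
  then have "(\<chi> j. real (level j)) \<in> flag_cone B L"
    unfolding flag_cone_def using closure_subset by blast
  then obtain c where "(\<chi> j. real (level j)) = (\<chi> j. c)" using assms by auto
  then have const: "level j = level j'" for j j'
    by (simp add: vec_eq_iff) (metis of_nat_eq_iff)
  have "length L = 2"
  proof (rule ccontr)
    assume "length L \<noteq> 2"
    then have "2 < length L" using length_ge by simp
    then obtain j j' where "level j = 1" "level j' = 2" using ex_level[of 1] ex_level[of 2] by auto
    then show False using const[of j j'] by simp
  qed
  then obtain M M' where "L = [M, M']" by (auto simp: numeral_2_eq_2 length_Suc_conv)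
  then show ?thesis using L_0 L_last by (simp add: trivial_flag_def)
qed

section \<open>The product of the induced arrangements as a linear section of the torus\<close>

text \<open>
  The image of \<open>\<Prod>\<^sub>i L\<^sub>i / L\<^bsub>i-1\<^esub>\<close> in affine space, with \<open>u i\<close> representing the component in \<open>L\<^sub>i / L\<^bsub>i-1\<^esub>\<close>.
\<close>
definition flag_space :: "(complex ^ 'b) set" where
  "flag_space = {x. \<exists>u. \<forall>j. u (level j) \<in> L ! level j \<and> x $ j = B j (u (level j))}"

lemma flag_complement_eq: "flag_complement B L = torus \<inter> flag_space"
proof (intro set_eqI iffI)
  fix x assume "x \<in> flag_complement B L"
  then have "x \<in> torus" and "\<forall>i. \<exists>v. 1 \<le> i \<and> i < length L \<longrightarrow> v \<in> L ! i \<and> (\<forall>j\<in>flag_block B L i. x $ j = B j v)"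
    by (auto simp: flag_complement_def)
  then obtain u where "\<And>i. 1 \<le> i \<Longrightarrow> i < length L \<Longrightarrow> u i \<in> L ! i \<and> (\<forall>j\<in>flag_block B L i. x $ j = B j (u i))"
    by metis
  then have "\<forall>j. u (level j) \<in> L ! level j \<and> x $ j = B j (u (level j))"
    using level_pos level_less by (simp add: block_iff_level)
  then show "x \<in> torus \<inter> flag_space" using \<open>x \<in> torus\<close> by (auto simp: flag_space_def)
next
  fix x assume "x \<in> torus \<inter> flag_space"
  then obtain u where x: "x \<in> torus" and u: "\<And>j. u (level j) \<in> L ! level j" "\<And>j. x $ j = B j (u (level j))"
    by (auto simp: flag_space_def)
  have "\<exists>v\<in>L ! i. \<forall>j\<in>flag_block B L i. x $ j = B j v" if "1 \<le> i \<and> i < length L" for i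
  proof -
    have "u i \<in> L ! i" using ex_level[of i] u(1) that by auto
    then show ?thesis using u(2) that by (auto simp: block_iff_level)
  qed
  then show "x \<in> flag_complement B L" using x by (auto simp: flag_complement_def)
qed

lemma subspace_flag_space: "vec.subspace flag_space"
proof (rule vec.subspaceI)
  show "0 \<in> flag_space"
    by (auto simp: flag_space_def intro!: exI[of _ "\<lambda>_. 0"] subspace_0 subspace_L level_less)
next
  fix x y assume "x \<in> flag_space" "y \<in> flag_space"
  then obtain u w where "\<forall>j. u (level j) \<in> L ! level j \<and> x $ j = B j (u (level j))"
    "\<forall>j. w (level j) \<in> L ! level j \<and> y $ j = B j (w (level j))"
    by (auto simp: flag_space_def)
  then show "x + y \<in> flag_space"
    by (auto simp: flag_space_def form_add intro!: exI[of _ "\<lambda>i. u i + w i"] subspace_add subspace_L level_less)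
next
  fix c x assume "x \<in> flag_space"
  then obtain u where "\<forall>j. u (level j) \<in> L ! level j \<and> x $ j = B j (u (level j))"
    by (auto simp: flag_space_def)
  then show "c *s x \<in> flag_space"
    by (auto simp: flag_space_def form_scale intro!: exI[of _ "\<lambda>i. scale c (u i)"] subspace_scale subspace_L level_less)
qed

text \<open>In each flat, a generic vector avoids the zeros of all the forms of the corresponding block.\<close>
lemma flag_complement_nonempty: "torus \<inter> flag_space \<noteq> {}"
proof -
  have "\<exists>v\<in>L ! i. \<forall>j\<in>{j. level j = i}. B j v \<noteq> 0" if "i < length L" for i
  proof (rule generic_vector)
    fix j assume "j \<in> {j. level j = i}"
    then show "\<exists>v\<in>L ! i. B j v \<noteq> 0"
      using forms_iff_level[of i j] that by (auto simp: flag_forms_def)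
  qed (simp_all add: subspace_L that)
  then have "\<forall>i. \<exists>v. i < length L \<longrightarrow> v \<in> L ! i \<and> (\<forall>j\<in>{j. level j = i}. B j v \<noteq> 0)"
    by blast
  then obtain u where "\<forall>i. i < length L \<longrightarrow> u i \<in> L ! i \<and> (\<forall>j\<in>{j. level j = i}. B j (u i) \<noteq> 0)"
    by (rule choice[THEN exE])
  then have u: "u (level j) \<in> L ! level j \<and> B j (u (level j)) \<noteq> 0" for j
    using level_less[of j] by blast
  then have "(\<chi> j. B j (u (level j))) \<in> torus \<inter> flag_space"
    by (auto simp: torus_def flag_space_def intro!: exI[of _ u])
  then show ?thesis by blast
qed

end

section \<open>Initial schemes\<close>

context flag
begin

text \<open>
  Let \<open>u\<^sub>i \<in> L\<^sub>i\<close> represent the components of \<open>x\<close>, and let \<open>w i\<close> be the value of \<open>\<omega>\<close> on the \<open>i\<close>-th block.  On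
  \<open>v(t) = \<Sum>\<^sub>i t\<^bsup>w i\<^esup> u\<^sub>i\<close> a form of the \<open>i\<close>-th block kills the terms before the \<open>i\<close>-th one, and the terms
  after it are of higher order in \<open>t\<close>, so its leading term is \<open>t\<^bsup>w i\<^esup> x\<^sub>j\<close>.
\<close>
lemma degeneration_curve:
  assumes x: "x \<in> flag_complement B L" and \<omega>: "\<omega> \<in> relint_lattice_points (flag_cone B L)"
  obtains v y where "\<And>t j. t \<noteq> 0 \<Longrightarrow> B j (v t) = t powi (\<omega> $ j) * y t $ j"
    and "(y \<longlongrightarrow> x) (at 0)"
proof -
  obtain u where u: "\<And>j. u (level j) \<in> L ! level j" and xu: "\<And>j. x $ j = B j (u (level j))"
    using x by (auto simp: flag_complement_eq flag_space_def)
  define w where "w i = \<omega> $ (SOME j. level j = i)" for i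
  have w: "w (level j) = \<omega> $ j" for j
  proof -
    have "level (SOME k. level k = level j) = level j" by (rule someI) simp
    then show ?thesis using \<omega> unfolding w_def relint_lattice_points_flag_cone by blast
  qed
  have w_less: "w i < w i'" if i: "1 \<le> i" "i < i'" "i' < length L" for i i'
  proof -
    have "1 \<le> i'" "i < length L" using i by simp_all
    then obtain j j' where jj': "level j = i" "level j' = i'"
      using ex_level[of i] ex_level[of i'] i by blast
    then have "\<omega> $ j < \<omega> $ j'" using \<omega> i unfolding relint_lattice_points_flag_cone by blast
    then show ?thesis using w[of j] w[of j'] jj' by simp
  qed
  define v where "v t = (\<Sum>i\<in>{1..<length L}. scale (t powi w i) (u i))" for t
  define y where "y t = (\<chi> j. \<Sum>i\<in>{level j..<length L}. t ^ nat (w i - w (level j)) * B j (u i))" for t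
  show thesis
  proof (rule that)
    fix t :: complex and j assume t: "t \<noteq> 0"
    have uL: "u i \<in> L ! i" if "1 \<le> i" "i < length L" for i
      using ex_level[OF that] u by auto
    have "B j (v t) = (\<Sum>i\<in>{1..<length L}. t powi w i * B j (u i))"
      by (simp add: v_def form_sum form_scale)
    also have "\<dots> = (\<Sum>i\<in>{level j..<length L}. t powi w i * B j (u i))"
      using level_pos[of j] form_vanishes_below[OF uL, of _ j]
      by (intro sum.mono_neutral_right) auto
    also have "\<dots> = (\<Sum>i\<in>{level j..<length L}. t powi w (level j) * (t ^ nat (w i - w (level j)) * B j (u i)))"
    proof (intro sum.cong refl)
      fix i assume i: "i \<in> {level j..<length L}"
      then have "w (level j) \<le> w i" using w_less[of "level j" i] level_pos[of j] by (cases "level j = i") auto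
      then have "t powi w i = t powi (w (level j) + int (nat (w i - w (level j))))" by simp
      then have "t powi w i = t powi w (level j) * t ^ nat (w i - w (level j))"
        using t by (simp only: power_int_add power_int_of_nat simp_thms)
      then show "t powi w i * B j (u i) = t powi w (level j) * (t ^ nat (w i - w (level j)) * B j (u i))" by simp
    qed
    finally show "B j (v t) = t powi (\<omega> $ j) * y t $ j"
      by (simp add: y_def w sum_distrib_left)
  next
    have "((\<lambda>t. y t $ j) \<longlongrightarrow> x $ j) (at 0)" for j
    proof -
      have "((\<lambda>t::complex. \<Sum>i\<in>{level j..<length L}. t ^ nat (w i - w (level j)) * B j (u i)) \<longlongrightarrow>
        (\<Sum>i\<in>{level j..<length L}. 0 ^ nat (w i - w (level j)) * B j (u i))) (at 0)"
        by (intro tendsto_intros)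
      also have "(\<Sum>i\<in>{level j..<length L}. 0 ^ nat (w i - w (level j)) * B j (u i)) =
        (\<Sum>i\<in>{level j..<length L}. if i = level j then B j (u i) else 0)"
        using w_less[of "level j"] level_pos[of j] by (intro sum.cong) auto
      also have "\<dots> = x $ j" using level_less[of j] by (simp add: xu)
      finally show ?thesis by (simp add: y_def)
    qed
    then show "(y \<longlongrightarrow> x) (at 0)" by (rule vec_tendstoI)
  qed
qed

text \<open>An equation of the degeneration persists in the limit along the curves constructed above.\<close>
lemma initial_scheme_subset:
  assumes \<omega>: "\<omega> \<in> relint_lattice_points (flag_cone B L)"
  shows "initial_scheme (arrangement_complement B) \<omega> \<subseteq> vanishing_ideal (flag_complement B L)"
proof
  fix g assume "g \<in> initial_scheme (arrangement_complement B) \<omega>"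
  then obtain f where g: "g = at_zero f" and f: "f \<in> closure_ideal (degeneration (arrangement_complement B) \<omega>)"
    by (auto simp: initial_scheme_def)
  have "laurent_eval g x = 0" if x: "x \<in> flag_complement B L" for x
  proof -
    obtain v y where v: "\<And>t j. t \<noteq> 0 \<Longrightarrow> B j (v t) = t powi (\<omega> $ j) * y t $ j" and y: "(y \<longlongrightarrow> x) (at 0)"
      using degeneration_curve[OF x \<omega>] by metis
    have xt: "x \<in> torus" using x by (simp add: flag_complement_def)
    have "\<forall>\<^sub>F t in at 0. line_laurent_eval f t (y t) = 0"
      using eventually_torus[OF y xt] eventually_neq_at_within[of 0]
    proof eventually_elim
      case (elim t)
      have "cocharacter_act \<omega> t (y t) = (\<chi> j. B j (v t))"
        using elim v by (simp add: cocharacter_act_def)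
      moreover have "(\<chi> j. B j (v t)) \<in> torus" using elim v by (simp add: torus_def)
      ultimately have "(t, y t) \<in> degeneration (arrangement_complement B) \<omega>"
        using elim by (simp add: degeneration_def arrangement_complement_eq)
      then show ?case using f by (auto simp: closure_ideal_def)
    qed
    then have "((\<lambda>t. 0) \<longlongrightarrow> line_laurent_eval f 0 x) (at (0::complex))"
      using tendsto_line_laurent_eval[OF y xt] by (rule Lim_transform_eventually[rotated])
    then have "line_laurent_eval f 0 x = 0" by (rule LIM_unique[OF _ tendsto_const])
    then show ?thesis by (simp add: g line_laurent_eval_at_zero)
  qed
  then show "g \<in> vanishing_ideal (flag_complement B L)" by (simp add: vanishing_ideal_def)
qed

text \<open>
  The maps for \<open>vanishing_ideal_lift\<close> come from projections \<open>P i\<close> onto the flats \<open>L ! i\<close>.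
  The point of the degeneration given by \<open>t\<close> and \<open>v\<close> is sent to the point of the flag space with
  components \<open>t\<^bsup>-w i\<^esup> P i v\<close>, where \<open>w i\<close> is the value of \<open>\<omega>\<close> on the \<open>i\<close>-th block.
  In coordinates, this map subtracts from \<open>x $ j\<close> a combination of
  the \<open>x $ m\<close> for forms \<open>m\<close> of higher blocks, each with the factor \<open>t ^ (\<omega> $ m - \<omega> $ j)\<close>; the
  inequalities of the cone say that these exponents are positive.
\<close>
lemma vanishing_ideal_subset:
  assumes \<omega>: "\<omega> \<in> relint_lattice_points (flag_cone B L)"
  shows "vanishing_ideal (flag_complement B L) \<subseteq> initial_scheme (arrangement_complement B) \<omega>"
proof
  fix g assume g: "g \<in> vanishing_ideal (flag_complement B L)"
  have "\<exists>P D. (\<forall>v. P v \<in> common_kernel (flag_forms B L i)) \<and>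
    (\<forall>v j. B j (P v) = B j v - (\<Sum>m\<in>flag_forms B L i. D j m * B m v))" for i
    by (rule kernel_projection[of "flag_forms B L i"]) blast
  then have "\<forall>i. \<exists>P D. (\<forall>v. P v \<in> common_kernel (flag_forms B L i)) \<and>
    (\<forall>v j. B j (P v) = B j v - (\<Sum>m\<in>flag_forms B L i. D j m * B m v))" ..
  then obtain P where "\<forall>i. \<exists>D. (\<forall>v. P i v \<in> common_kernel (flag_forms B L i)) \<and>
    (\<forall>v j. B j (P i v) = B j v - (\<Sum>m\<in>flag_forms B L i. D j m * B m v))"
    by (rule choice[THEN exE])
  then obtain D where PD: "\<forall>i. (\<forall>v. P i v \<in> common_kernel (flag_forms B L i)) \<and>
    (\<forall>v j. B j (P i v) = B j v - (\<Sum>m\<in>flag_forms B L i. D i j m * B m v))"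
    by (rule choice[THEN exE])
  then have P: "P i v \<in> common_kernel (flag_forms B L i)"
    and BP: "B j (P i v) = B j v - (\<Sum>m\<in>flag_forms B L i. D i j m * B m v)" for i j v
    by blast+
  define D' where "D' j m = (if level j < level m then D (level j) j m else 0)" for j m
  obtain y\<^sub>0 where y\<^sub>0: "y\<^sub>0 \<in> torus \<inter> flag_space" using flag_complement_nonempty by blast
  have \<omega>_less: "\<omega> $ j < \<omega> $ m" if "level j < level m" for j m
    using \<omega> that unfolding relint_lattice_points_flag_cone by blast
  have \<omega>_eq: "\<omega> $ j = \<omega> $ m" if "level j = level m" for j m
    using \<omega> that unfolding relint_lattice_points_flag_cone by blast
  show "g \<in> initial_scheme (arrangement_complement B) \<omega>"
    unfolding initial_scheme_def
  proof (rule vanishing_ideal_lift[where D = D' and e = "\<lambda>j m. nat (\<omega> $ m - \<omega> $ j)" and W = flag_space])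
    show "0 < nat (\<omega> $ m - \<omega> $ j)" if "D' j m \<noteq> 0" for j m
      using \<omega>_less[of j m] that by (simp add: D'_def split: if_splits)
    show "vec.subspace flag_space" by (rule subspace_flag_space)
    show "y\<^sub>0 \<in> torus \<inter> flag_space" by (rule y\<^sub>0)
    show "g \<in> vanishing_ideal (torus \<inter> flag_space)" using g by (simp add: flag_complement_eq)
    fix t x assume "(t, x) \<in> degeneration (arrangement_complement B) \<omega>"
    then obtain v where t: "t \<noteq> 0" and x: "x \<in> torus" and "cocharacter_act \<omega> t x = (\<chi> j. B j v)"
      by (auto simp: degeneration_def arrangement_complement_eq)
    then have tx: "t powi (\<omega> $ j) * x $ j = B j v" for j
      by (simp add: cocharacter_act_def vec_eq_iff)
    define w where "w i = \<omega> $ (SOME j. level j = i)" for i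
    have w: "w (level j) = \<omega> $ j" for j
      unfolding w_def by (rule \<omega>_eq) (rule someI, simp)
    define u where "u i = scale (t powi (- w i)) (P i v)" for i
    have "u (level j) \<in> L ! level j" for j
      unfolding u_def using P[of "level j" v] L_kernel[OF level_less[of j]]
      by (auto intro: subspace_scale subspace_L level_less)
    moreover have "x $ j - (\<Sum>m\<in>UNIV. D' j m * t ^ nat (\<omega> $ m - \<omega> $ j) * x $ m) = B j (u (level j))" for j
    proof -
      have "(\<Sum>m\<in>UNIV. D' j m * t ^ nat (\<omega> $ m - \<omega> $ j) * x $ m) =
        (\<Sum>m\<in>flag_forms B L (level j). D' j m * t ^ nat (\<omega> $ m - \<omega> $ j) * x $ m)"
        using forms_iff_level[OF level_less[of j]]
        by (intro sum.mono_neutral_right) (auto simp: D'_def)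
      also have "\<dots> = (\<Sum>m\<in>flag_forms B L (level j). t powi (- \<omega> $ j) * (D (level j) j m * B m v))"
      proof (intro sum.cong refl)
        fix m assume "m \<in> flag_forms B L (level j)"
        then have less: "level j < level m" using forms_iff_level[OF level_less[of j]] by blast
        have "t ^ nat (\<omega> $ m - \<omega> $ j) = t powi (\<omega> $ m - \<omega> $ j)"
          using \<omega>_less[OF less] by (simp add: power_int_def)
        also have "\<dots> = t powi (- \<omega> $ j + \<omega> $ m)" by (simp add: add.commute)
        also have "\<dots> = t powi (- \<omega> $ j) * t powi (\<omega> $ m)"
          by (rule power_int_add) (use t in simp)
        finally show "D' j m * t ^ nat (\<omega> $ m - \<omega> $ j) * x $ m = t powi (- \<omega> $ j) * (D (level j) j m * B m v)"
          using less by (simp add: D'_def flip: tx)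
      qed
      also have "\<dots> = t powi (- \<omega> $ j) * (B j v - B j (P (level j) v))"
        by (simp add: BP sum_distrib_left)
      finally have sum: "(\<Sum>m\<in>UNIV. D' j m * t ^ nat (\<omega> $ m - \<omega> $ j) * x $ m) =
        t powi (- \<omega> $ j) * (B j v - B j (P (level j) v))" .
      have "x $ j = t powi (- \<omega> $ j) * B j v"
        using t by (simp add: power_int_minus flip: tx)
      then show ?thesis unfolding sum by (simp add: u_def form_scale w right_diff_distrib)
    qed
    ultimately have "(\<chi> j. x $ j - (\<Sum>m\<in>UNIV. D' j m * t ^ nat (\<omega> $ m - \<omega> $ j) * x $ m)) \<in> flag_space"
      unfolding flag_space_def by (auto intro!: exI[of _ u])
    then show "x \<in> torus \<and> (\<chi> j. x $ j - (\<Sum>m\<in>UNIV. D' j m * t ^ nat (\<omega> $ m - \<omega> $ j) * x $ m)) \<in> flag_space"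
      using x by simp
  qed
qed

lemma initial_scheme_flag_cone:
  "\<omega> \<in> relint_lattice_points (flag_cone B L) \<Longrightarrow>
    initial_scheme (arrangement_complement B) \<omega> = vanishing_ideal (flag_complement B L)"
  using initial_scheme_subset vanishing_ideal_subset by blast

lemma has_common_initial_scheme_flag_cone: "has_common_initial_scheme (arrangement_complement B) (flag_cone B L)"
  unfolding has_common_initial_scheme_def
  using level_lattice_point initial_scheme_flag_cone by auto

lemma cone_initial_scheme_flag_cone:
  "cone_initial_scheme (arrangement_complement B) (flag_cone B L) = vanishing_ideal (flag_complement B L)"
  unfolding cone_initial_scheme_def
proof (rule the_equality)
  show "\<forall>\<omega>\<in>relint_lattice_points (flag_cone B L).
    initial_scheme (arrangement_complement B) \<omega> = vanishing_ideal (flag_complement B L)"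
    by (simp add: initial_scheme_flag_cone)
  show "I = vanishing_ideal (flag_complement B L)"
    if "\<forall>\<omega>\<in>relint_lattice_points (flag_cone B L). initial_scheme (arrangement_complement B) \<omega> = I" for I
    using that level_lattice_point initial_scheme_flag_cone by blast
qed

end

section \<open>The closure of the coamoeba\<close>

lemma arg_map_nth: "arg_map x $ j = sgn (x $ j)"
  by (simp add: arg_map_def Complex.sgn_eq)

lemma tendsto_arg_map:
  assumes "(y \<longlongrightarrow> x) F" "x \<in> torus"
  shows "((\<lambda>t. arg_map (y t)) \<longlongrightarrow> arg_map x) F"
  using assms(2)
  by (intro vec_tendstoI) (auto simp: arg_map_nth torus_def intro!: tendsto_sgn tendsto_vec_nth assms(1))

text \<open>
  Along the curve with leading exponents \<open>level j\<close>, real positive \<open>t\<close> rescale the coordinates by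
  positive numbers, which the argument map does not see.
\<close>
lemma (in flag) coamoeba_flag_complement_subset:
  "coamoeba (flag_complement B L) \<subseteq> closure (coamoeba (arrangement_complement B))"
proof
  fix z assume "z \<in> coamoeba (flag_complement B L)"
  then obtain x where x: "x \<in> flag_complement B L" and z: "z = arg_map x" by (auto simp: coamoeba_def)
  have xt: "x \<in> torus" using x by (simp add: flag_complement_def)
  obtain v y where v: "\<And>t j. t \<noteq> 0 \<Longrightarrow> B j (v t) = t powi int (level j) * y t $ j" and y: "(y \<longlongrightarrow> x) (at 0)"
    using degeneration_curve[OF x level_lattice_point] by auto
  have "filterlim complex_of_real (at 0) (at_right 0)"
    by (auto simp: filterlim_at eventually_at_filter intro!: tendsto_eq_intros)
  then have lim: "((\<lambda>s. y (complex_of_real s)) \<longlongrightarrow> x) (at_right 0)"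
    by (rule filterlim_compose[OF y])
  show "z \<in> closure (coamoeba (arrangement_complement B))"
  proof (rule Lim_in_closed_set)
    show "((\<lambda>s. arg_map (y (complex_of_real s))) \<longlongrightarrow> z) (at_right 0)"
      unfolding z by (rule tendsto_arg_map[OF lim xt])
    show "\<forall>\<^sub>F s in at_right 0. arg_map (y (complex_of_real s)) \<in> closure (coamoeba (arrangement_complement B))"
      using eventually_torus[OF lim xt] eventually_at_right_less[of 0]
    proof eventually_elim
      case (elim s)
      have Bv: "B j (v s) = (s powi int (level j)) *\<^sub>R (y (complex_of_real s) $ j)" for j
        using v[of s j] elim by (simp add: scaleR_conv_of_real)
      have "arg_map (\<chi> j. B j (v s)) = arg_map (y (complex_of_real s))"
        using elim by (simp add: vec_eq_iff arg_map_nth Bv sgn_scaleR)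
      moreover have "(\<chi> j. B j (v s)) \<in> arrangement_complement B"
      proof -
        have "B j (v s) \<noteq> 0" for j using elim by (simp add: Bv torus_def)
        then show ?thesis by (auto simp: arrangement_complement_eq torus_def)
      qed
      ultimately have "arg_map (y (complex_of_real s)) \<in> coamoeba (arrangement_complement B)"
        unfolding coamoeba_def by (metis imageI)
      then show ?case using closure_subset by blast
    qed
  qed auto
qed

context separating_forms
begin

text \<open>
  Divide the vectors of values of the forms in \<open>F\<close> by their norms and pass to a convergent
  subsequence.  The limit has norm \<open>1\<close> and is again a vector of values, since these form a closed
  subspace.  It tells the limiting phase of those forms in \<open>F\<close> that decay the slowest.
\<close>
lemma limit_direction:
  assumes z: "(\<lambda>n. arg_map (\<chi> j. B j (v n))) \<longlonglongrightarrow> z" and v: "\<And>n j. B j (v n) \<noteq> 0" and F: "F \<noteq> {}"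
  obtains w where "\<exists>j\<in>F. B j w \<noteq> 0" and "\<And>j. j \<in> F \<Longrightarrow> B j w \<noteq> 0 \<Longrightarrow> sgn (B j w) = z $ j"
proof -
  define T where "T u = (\<chi> j. if j \<in> F then B j u else 0)" for u
  have T_add: "T (u + u') = T u + T u'" and T_scale: "T (scale c u) = c *s T u" for u u' c
    by (simp_all add: T_def vec_eq_iff form_add form_scale)
  have scaleR_T: "r *\<^sub>R T u = T (scale (complex_of_real r) u)" for r u
    unfolding T_scale vec_eq_iff vector_scaleR_component vector_smult_component by (simp add: scaleR_conv_of_real)
  have "closed (range T)"
  proof (rule closed_subspace, rule real_vector.subspaceI)
    have "T 0 = 0" by (simp add: T_def vec_eq_iff)
    then show "0 \<in> range T" by (metis rangeI)
  qed (auto simp: scaleR_T simp flip: T_add)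
  have Tv: "T (v n) \<noteq> 0" for n
    using F v by (auto simp: T_def vec_eq_iff)
  define s where "s n = inverse (norm (T (v n))) *\<^sub>R T (v n)" for n
  have "s n \<in> sphere 0 1" for n using Tv[of n] by (simp add: s_def)
  then obtain l k where l: "l \<in> sphere 0 1" and k: "strict_mono (k :: nat \<Rightarrow> nat)" and lim: "(s \<circ> k) \<longlonglongrightarrow> l"
    using compact_sphere[of 0 1] unfolding compact_def by (metis (no_types, lifting))
  have "s n \<in> range T" for n by (auto simp: s_def scaleR_T)
  then have "l \<in> range T" using closed_sequentially[OF \<open>closed (range T)\<close> _ lim] by simp
  then obtain w where w: "l = T w" by auto
  show thesis
  proof (rule that)
    have "T w \<noteq> 0" using l w by auto
    then show "\<exists>j\<in>F. B j w \<noteq> 0" by (auto simp: T_def vec_eq_iff split: if_splits)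
    fix j assume j: "j \<in> F" "B j w \<noteq> 0"
    have "(\<lambda>n. (s \<circ> k) n $ j) \<longlonglongrightarrow> B j w"
      using tendsto_vec_nth[OF lim, of j] j by (simp add: w T_def)
    then have "(\<lambda>n. sgn ((s \<circ> k) n $ j)) \<longlonglongrightarrow> sgn (B j w)" using j by (intro tendsto_sgn)
    moreover have "sgn ((s \<circ> k) n $ j) = arg_map (\<chi> j. B j (v (k n))) $ j" for n
      using j Tv[of "k n"] by (simp add: s_def T_def arg_map_nth sgn_scaleR)
    moreover have "(\<lambda>n. arg_map (\<chi> j. B j (v (k n))) $ j) \<longlonglongrightarrow> z $ j"
      using tendsto_vec_nth[OF LIMSEQ_subseq_LIMSEQ[OF z k], of j] by (simp add: o_def)
    ultimately show "sgn (B j w) = z $ j" using LIMSEQ_unique by simp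
  qed
qed

lemma flag_block_Cons:
  assumes "2 \<le> i"
  shows "flag_block B (M # L) i = flag_block B L (i - 1)"
proof -
  obtain k where "i = Suc (Suc k)" using assms by (metis add_2_eq_Suc le_Suc_ex)
  then show ?thesis by (simp add: flag_block_def flag_forms_def)
qed

text \<open>
  Peel off the forms in the order of their rates of decay: the forms of \<open>F\<close> that are nonzero in the
  limit direction make up the first block, and the remaining ones define the next flat.  The
  assumption on \<open>F\<close> says that \<open>F\<close> contains all the forms vanishing on its flat; it is inherited by the
  remaining set and makes the inclusions of flats strict.  The sequence \<open>v\<close> stays fixed in the
  induction, because its phases converge whichever subsequence is used in a step.
\<close>
lemma limit_flag:
  assumes z: "(\<lambda>n. arg_map (\<chi> j. B j (v n))) \<longlonglongrightarrow> z" and v: "\<And>n j. B j (v n) \<noteq> 0"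
    and F: "{j. \<forall>u\<in>common_kernel F. B j u = 0} = F"
  shows "\<exists>L u. L \<noteq> [] \<and> hd L = common_kernel F \<and> last L = UNIV \<and> set L \<subseteq> flats B \<and> sorted_wrt (\<subset>) L \<and>
    (\<forall>i. 1 \<le> i \<and> i < length L \<longrightarrow> u i \<in> L ! i \<and>
      (\<forall>j\<in>flag_block B L i. B j (u i) \<noteq> 0 \<and> sgn (B j (u i)) = z $ j))"
  using F
proof (induction "card F" arbitrary: F rule: less_induct)
  case less
  show ?case
  proof (cases "F = {}")
    case True
    then have "common_kernel F = UNIV" by (simp add: common_kernel_def)
    moreover have "UNIV \<in> flats B" using \<open>common_kernel F = UNIV\<close> by (metis flats_eq rangeI)
    ultimately show ?thesis by (intro exI[of _ "[UNIV]"]) auto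
  next
    case False
    obtain w where w: "\<exists>j\<in>F. B j w \<noteq> 0" and sgn_w: "\<And>j. j \<in> F \<Longrightarrow> B j w \<noteq> 0 \<Longrightarrow> sgn (B j w) = z $ j"
      using limit_direction[OF z v False] by metis
    define F' where "F' = {j\<in>F. B j w = 0}"
    have "F' \<subset> F" using w by (auto simp: F'_def)
    have "w \<in> common_kernel F'" by (simp add: F'_def common_kernel_def)
    have "common_kernel F \<subseteq> common_kernel F'" using \<open>F' \<subset> F\<close> by (auto simp: common_kernel_def)
    have F'_closed: "{j. \<forall>u\<in>common_kernel F'. B j u = 0} = F'"
    proof
      show "{j. \<forall>u\<in>common_kernel F'. B j u = 0} \<subseteq> F'"
        using less.prems \<open>common_kernel F \<subseteq> common_kernel F'\<close> \<open>w \<in> common_kernel F'\<close> unfolding F'_def by blast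
    qed (auto simp: common_kernel_def)
    have "card F' < card F" using \<open>F' \<subset> F\<close> by (simp add: psubset_card_mono)
    from less.hyps[OF this F'_closed] obtain L u where L: "L \<noteq> []" "hd L = common_kernel F'" "last L = UNIV"
      "set L \<subseteq> flats B" "sorted_wrt (\<subset>) L" and
      u: "\<And>i. 1 \<le> i \<Longrightarrow> i < length L \<Longrightarrow> u i \<in> L ! i \<and>
        (\<forall>j\<in>flag_block B L i. B j (u i) \<noteq> 0 \<and> sgn (B j (u i)) = z $ j)"
      by blast
    have "common_kernel F \<noteq> common_kernel F'" using less.prems F'_closed \<open>F' \<subset> F\<close> by blast
    then have strict: "common_kernel F \<subset> common_kernel F'" using \<open>common_kernel F \<subseteq> common_kernel F'\<close> by blast
    have sorted: "sorted_wrt (\<subset>) (common_kernel F # L)"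
    proof (cases L)
      case (Cons M L')
      then have "M = common_kernel F'" "\<forall>N\<in>set L'. common_kernel F' \<subset> N" using L by simp_all
      then have "\<forall>N\<in>set L. common_kernel F \<subset> N" using strict Cons psubset_trans by (metis set_ConsD)
      with L show ?thesis by simp
    qed simp
    define u' where "u' i = (if i = 1 then w else u (i - 1))" for i
    have "u' i \<in> (common_kernel F # L) ! i \<and>
      (\<forall>j\<in>flag_block B (common_kernel F # L) i. B j (u' i) \<noteq> 0 \<and> sgn (B j (u' i)) = z $ j)"
      if i: "1 \<le> i" "i < length (common_kernel F # L)" for i
    proof (cases "i = 1")
      case True
      have L0: "L ! 0 = common_kernel F'" using L by (metis hd_conv_nth)
      have "flag_block B (common_kernel F # L) 1 = F - F'"
        using less.prems F'_closed by (simp add: flag_block_def flag_forms_def L0)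
      then show ?thesis using True L0 \<open>w \<in> common_kernel F'\<close> sgn_w by (auto simp: u'_def F'_def)
    next
      case False
      then have "2 \<le> i" using i by simp
      then show ?thesis using u[of "i - 1"] i False
        by (simp add: flag_block_Cons[OF \<open>2 \<le> i\<close>] u'_def nth_Cons')
    qed
    moreover have "common_kernel F \<in> flats B" by (simp add: flats_eq)
    ultimately show ?thesis using L sorted
      by (intro exI[of _ "common_kernel F # L"] exI[of _ u']) auto
  qed
qed

lemma closure_coamoeba_subset:
  "closure (coamoeba (arrangement_complement B)) \<subseteq> (\<Union>L\<in>{L. flag_of_flats B L}. coamoeba (flag_complement B L))"
proof
  fix z assume "z \<in> closure (coamoeba (arrangement_complement B))"
  then obtain a where a: "\<And>n. a n \<in> coamoeba (arrangement_complement B)" and "a \<longlonglongrightarrow> z"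
    by (auto simp: closure_sequential)
  have "\<forall>n. \<exists>v. a n = arg_map (\<chi> j. B j v) \<and> (\<forall>j. B j v \<noteq> 0)"
    using a by (fastforce simp: coamoeba_def arrangement_complement_eq torus_def)
  then obtain v where v: "\<forall>n. a n = arg_map (\<chi> j. B j (v n)) \<and> (\<forall>j. B j (v n) \<noteq> 0)"
    by (rule choice[THEN exE])
  then have "a = (\<lambda>n. arg_map (\<chi> j. B j (v n)))" by (intro ext) blast
  with \<open>a \<longlonglongrightarrow> z\<close> have z: "(\<lambda>n. arg_map (\<chi> j. B j (v n))) \<longlonglongrightarrow> z" by (rule subst[rotated])
  have kernel_UNIV: "common_kernel UNIV = {0}" using separating by (auto simp: common_kernel_def)
  have "B j (v n) \<noteq> 0" for n j using v by blast
  moreover have "{j. \<forall>u\<in>{0}. B j u = 0} = UNIV" by simp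
  ultimately obtain L u where L: "L \<noteq> []" "hd L = {0}" "last L = UNIV" "set L \<subseteq> flats B" "sorted_wrt (\<subset>) L"
    and u: "\<forall>i. 1 \<le> i \<and> i < length L \<longrightarrow> u i \<in> L ! i \<and>
      (\<forall>j\<in>flag_block B L i. B j (u i) \<noteq> 0 \<and> sgn (B j (u i)) = z $ j)"
    by (rule limit_flag[OF z, of UNIV, unfolded kernel_UNIV, THEN exE]) (elim exE conjE, rule that)
  have "UNIV \<noteq> {0 :: 'v}"
    using form_nonzero[of undefined] by (metis UNIV_I form_0 singletonD)
  then have "2 \<le> length L" using L by (cases L; cases "tl L") auto
  then have flag: "flag_of_flats B L" using L by (simp add: flag_of_flats_def)
  interpret flag scale B L by unfold_locales (rule flag)
  have u_level: "u (level j) \<in> L ! level j \<and> B j (u (level j)) \<noteq> 0 \<and> sgn (B j (u (level j))) = z $ j" for j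
    using u level_pos[of j] level_less[of j] block_iff_level[of "level j" j] by blast
  define x where "x = (\<chi> j. B j (u (level j)))"
  have "x \<in> flag_complement B L"
    using u_level by (auto simp: flag_complement_eq torus_def flag_space_def x_def)
  moreover have "arg_map x = z" using u_level by (simp add: vec_eq_iff arg_map_nth x_def)
  ultimately show "z \<in> (\<Union>L\<in>{L. flag_of_flats B L}. coamoeba (flag_complement B L))"
    using flag by (auto simp: coamoeba_def)
qed

lemma closure_coamoeba_arrangement_complement:
  "closure (coamoeba (arrangement_complement B)) = (\<Union>L\<in>{L. flag_of_flats B L}. coamoeba (flag_complement B L))"
proof
  have "coamoeba (flag_complement B L) \<subseteq> closure (coamoeba (arrangement_complement B))" if "flag_of_flats B L" for L
  proof -
    interpret flag scale B L by unfold_locales (rule that)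
    show ?thesis by (rule coamoeba_flag_complement_subset)
  qed
  then show "(\<Union>L\<in>{L. flag_of_flats B L}. coamoeba (flag_complement B L)) \<subseteq> closure (coamoeba (arrangement_complement B))"
    by blast
qed (rule closure_coamoeba_subset)

end

section \<open>Initial schemes, phase limit sets and coamoebas of arrangement complements\<close>

text \<open>Every nonzero vector is detected by some linear functional, hence by a member of a spanning family.\<close>
lemma separating_forms_of_spanning:
  fixes scale :: "complex \<Rightarrow> 'v::ab_group_add \<Rightarrow> 'v" and B :: "'b::finite \<Rightarrow> 'v \<Rightarrow> complex"
  assumes "vector_space scale"
    and linear: "\<And>j. Vector_Spaces.linear scale (*) (B j)"
    and nonzero: "\<And>j. B j \<noteq> (\<lambda>v. 0)"
    and spanning: "\<And>\<phi>. Vector_Spaces.linear scale (*) \<phi> \<Longrightarrow> \<exists>c. \<phi> = (\<lambda>v. \<Sum>j\<in>UNIV. c j * B j v)"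
  shows "separating_forms scale B"
proof -
  interpret vector_space scale by fact
  interpret pair: vector_space_pair scale "(*) :: complex \<Rightarrow> complex \<Rightarrow> complex" by unfold_locales
  show ?thesis
  proof (intro separating_forms.intro separating_forms_axioms.intro)
    show "vector_space scale" by fact
    show "Vector_Spaces.linear scale (*) (B j)" for j by (rule linear)
    show "\<exists>v. B j v \<noteq> 0" for j using nonzero[of j] by auto
    show "v = 0" if Bv: "\<And>j. B j v = 0" for v
    proof (rule ccontr)
      assume "v \<noteq> 0"
      then have "independent {v}" by simp
      then obtain \<phi> where \<phi>: "Vector_Spaces.linear scale (*) \<phi>" "\<phi> v = 1"
        using pair.linear_independent_extend[of "{v}" "\<lambda>_. 1"] by auto
      then show False using spanning[OF \<phi>(1)] Bv by auto
    qed
  qed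
qed

theorem corollary2p6:
  fixes scale :: "complex \<Rightarrow> 'v::ab_group_add \<Rightarrow> 'v"
    and Basis :: "'v set"
    and B :: "'b::finite \<Rightarrow> 'v \<Rightarrow> complex"
  assumes "finite_dimensional_vector_space scale Basis"
    and "\<And>j. Vector_Spaces.linear scale (*) (B j)"
    and "\<And>j. B j \<noteq> (\<lambda>v. 0)"
    and "\<And>\<phi>. Vector_Spaces.linear scale (*) \<phi> \<Longrightarrow> \<exists>c. \<phi> = (\<lambda>v. \<Sum>j\<in>UNIV. c j * B j v)"
  shows "(\<forall>L. flag_of_flats B L \<longrightarrow>
            has_common_initial_scheme (arrangement_complement B) (flag_cone B L) \<and>
            cone_initial_scheme (arrangement_complement B) (flag_cone B L) =
              vanishing_ideal (flag_complement B L) \<and>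
            scheme_points (cone_initial_scheme (arrangement_complement B) (flag_cone B L)) =
              flag_complement B L) \<and>
         (\<forall>L. flag_of_flats B L \<and> L \<noteq> trivial_flag \<longrightarrow>
            phase_limit_cone (arrangement_complement B) (flag_cone B L) =
              closure (coamoeba (flag_complement B L))) \<and>
         closure (coamoeba (arrangement_complement B)) =
           (\<Union>L\<in>{L. flag_of_flats B L}. coamoeba (flag_complement B L)) \<and>
         (\<forall>L. flag_of_flats B L \<and> L \<noteq> trivial_flag \<longrightarrow>
            closure (coamoeba (flag_complement B L)) \<in> phase_limit_strata B)"
proof -
  have "vector_space scale" using assms(1) by (rule finite_dimensional_vector_space.axioms)
  then interpret separating_forms scale B
    using assms(2-4) by (rule separating_forms_of_spanning)
  have init: "has_common_initial_scheme (arrangement_complement B) (flag_cone B L)"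
    "cone_initial_scheme (arrangement_complement B) (flag_cone B L) = vanishing_ideal (flag_complement B L)"
    "scheme_points (vanishing_ideal (flag_complement B L)) = flag_complement B L"
    and cone: "flag_cone B L = range (\<lambda>c. \<chi> j. c) \<Longrightarrow> L = trivial_flag"
    if "flag_of_flats B L" for L
  proof -
    interpret flag scale B L by unfold_locales (rule that)
    show "has_common_initial_scheme (arrangement_complement B) (flag_cone B L)"
      by (rule has_common_initial_scheme_flag_cone)
    show "cone_initial_scheme (arrangement_complement B) (flag_cone B L) = vanishing_ideal (flag_complement B L)"
      by (rule cone_initial_scheme_flag_cone)
    show "scheme_points (vanishing_ideal (flag_complement B L)) = flag_complement B L"
      unfolding flag_complement_eq by (rule scheme_points_vanishing_ideal_subspace[OF subspace_flag_space])
    show "flag_cone B L = range (\<lambda>c. \<chi> j. c) \<Longrightarrow> L = trivial_flag"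
      by (rule flag_cone_eq_line)
  qed
  have phase: "phase_limit_cone (arrangement_complement B) (flag_cone B L) = closure (coamoeba (flag_complement B L))"
    if "flag_of_flats B L" for L
    using init[OF that] by (simp add: phase_limit_cone_def)
  have strata: "closure (coamoeba (flag_complement B L)) \<in> phase_limit_strata B"
    if "flag_of_flats B L" "L \<noteq> trivial_flag" for L
    unfolding phase_limit_strata_def fine_subdivision_def
    using phase[OF that(1)] cone[OF that(1)] that by blast
  show ?thesis
    using init phase strata closure_coamoeba_arrangement_complement by simp
qed

end
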